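(* Let $X$ be a left near-truss. Then there is a one-to-one correspondence between: (a) the set $A$ of all idempotent left near-truss endomorphisms of $X$; (b) the set $B$ of all pairs $(\omega,Y)$, where $\omega$ is a congruence on the left near-truss $X$, $Y$ is a subnear-truss of $X$, and $X=\omega\rtimes Y$.
   Context: A heap is a set $X$ with a ternary operation $[x,y,z]$ such that $[[x,y,z],w,u]=[x,y,[z,w,u]]$, $[x,x,y]=y$ and $[x,y,y]=x$ for all $x,y,z,w,u\in X$. A left near-truss $(X,[-,-,-],\cdot)$ is a heap $(X,[-,-,-])$ with an associative binary operation $\cdot$ such that $x\cdot[y,z,w]=[x\cdot y,x\cdot z,x\cdot w]$ for all $x,y,z,w\in X$. Morphisms preserve both operations; a subnear-truss is a subset closed under both operations; a congruence is an equivalence relation compatible with both operations. $[x]_\omega$ denotes the class of $x$ modulo $\omega$. $X=\omega\rtimes Y$ ($X$ is the inner semidirect product of $\omega$ and $Y$) means that $Y\cap[x]_\omega$ is a singleton for every $x\in X$. *)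

theory Defs
  imports "HOL-Library.FuncSet"
begin

text \<open>The carrier of a heap is allowed to be empty.\<close>

locale heap_structure =
  fixes X :: "'a set"
    and t :: "'a \<Rightarrow> 'a \<Rightarrow> 'a \<Rightarrow> 'a"
  assumes bracket_closed: "\<lbrakk>x \<in> X; y \<in> X; z \<in> X\<rbrakk> \<Longrightarrow> t x y z \<in> X"
    and bracket_assoc: "\<lbrakk>x \<in> X; y \<in> X; z \<in> X; w \<in> X; u \<in> X\<rbrakk> \<Longrightarrow>
      t (t x y z) w u = t x y (t z w u)"
    and malcev_left: "\<lbrakk>x \<in> X; y \<in> X\<rbrakk> \<Longrightarrow> t x x y = y"
    and malcev_right: "\<lbrakk>x \<in> X; y \<in> X\<rbrakk> \<Longrightarrow> t x y y = x"

locale left_near_truss = heap_structure X t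
  for X :: "'a set"
    and t :: "'a \<Rightarrow> 'a \<Rightarrow> 'a \<Rightarrow> 'a"
    and m :: "'a \<Rightarrow> 'a \<Rightarrow> 'a" +
  assumes mult_closed: "\<lbrakk>x \<in> X; y \<in> X\<rbrakk> \<Longrightarrow> m x y \<in> X"
    and mult_assoc: "\<lbrakk>x \<in> X; y \<in> X; z \<in> X\<rbrakk> \<Longrightarrow> m (m x y) z = m x (m y z)"
    and left_distrib: "\<lbrakk>x \<in> X; y \<in> X; z \<in> X; w \<in> X\<rbrakk> \<Longrightarrow>
      m x (t y z w) = t (m x y) (m x z) (m x w)"

text \<open>Maps are taken in \<^term>\<open>X \<rightarrow>\<^sub>E X'\<close>, so that two morphisms agreeing on the carrier
  are equal.\<close>

definition near_truss_hom ::
  "'a set \<Rightarrow> ('a \<Rightarrow> 'a \<Rightarrow> 'a \<Rightarrow> 'a) \<Rightarrow> ('a \<Rightarrow> 'a \<Rightarrow> 'a) \<Rightarrow>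
   'b set \<Rightarrow> ('b \<Rightarrow> 'b \<Rightarrow> 'b \<Rightarrow> 'b) \<Rightarrow> ('b \<Rightarrow> 'b \<Rightarrow> 'b) \<Rightarrow> ('a \<Rightarrow> 'b) set"
  where "near_truss_hom X t m X' t' m' =
    {f \<in> X \<rightarrow>\<^sub>E X'.
      (\<forall>x\<in>X. \<forall>y\<in>X. \<forall>z\<in>X. f (t x y z) = t' (f x) (f y) (f z)) \<and>
      (\<forall>x\<in>X. \<forall>y\<in>X. f (m x y) = m' (f x) (f y))}"

definition idempotent_endomorphisms ::
  "'a set \<Rightarrow> ('a \<Rightarrow> 'a \<Rightarrow> 'a \<Rightarrow> 'a) \<Rightarrow> ('a \<Rightarrow> 'a \<Rightarrow> 'a) \<Rightarrow> ('a \<Rightarrow> 'a) set"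
  where "idempotent_endomorphisms X t m =
    {e \<in> near_truss_hom X t m X t m. compose X e e = e}"

definition subnear_truss ::
  "'a set \<Rightarrow> 'a set \<Rightarrow> ('a \<Rightarrow> 'a \<Rightarrow> 'a \<Rightarrow> 'a) \<Rightarrow> ('a \<Rightarrow> 'a \<Rightarrow> 'a) \<Rightarrow> bool"
  where "subnear_truss Y X t m \<longleftrightarrow>
    Y \<subseteq> X \<and>
    (\<forall>x\<in>Y. \<forall>y\<in>Y. \<forall>z\<in>Y. t x y z \<in> Y) \<and>
    (\<forall>x\<in>Y. \<forall>y\<in>Y. m x y \<in> Y)"

definition near_truss_congruence ::
  "('a \<times> 'a) set \<Rightarrow> 'a set \<Rightarrow> ('a \<Rightarrow> 'a \<Rightarrow> 'a \<Rightarrow> 'a) \<Rightarrow> ('a \<Rightarrow> 'a \<Rightarrow> 'a) \<Rightarrow> bool"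
  where "near_truss_congruence \<omega> X t m \<longleftrightarrow>
    equiv X \<omega> \<and>
    (\<forall>x x' y y' z z'. (x, x') \<in> \<omega> \<longrightarrow> (y, y') \<in> \<omega> \<longrightarrow> (z, z') \<in> \<omega> \<longrightarrow>
      (t x y z, t x' y' z') \<in> \<omega>) \<and>
    (\<forall>x x' y y'. (x, x') \<in> \<omega> \<longrightarrow> (y, y') \<in> \<omega> \<longrightarrow> (m x y, m x' y') \<in> \<omega>)"

definition inner_semidirect_product :: "'a set \<Rightarrow> ('a \<times> 'a) set \<Rightarrow> 'a set \<Rightarrow> bool"
  where "inner_semidirect_product X \<omega> Y \<longleftrightarrow> (\<forall>x\<in>X. is_singleton (Y \<inter> \<omega> `` {x}))"

definition semidirect_decompositions ::
  "'a set \<Rightarrow> ('a \<Rightarrow> 'a \<Rightarrow> 'a \<Rightarrow> 'a) \<Rightarrow> ('a \<Rightarrow> 'a \<Rightarrow> 'a) \<Rightarrow> (('a \<times> 'a) set \<times> 'a set) set"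
  where "semidirect_decompositions X t m =
    {(\<omega>, Y). near_truss_congruence \<omega> X t m \<and> subnear_truss Y X t m \<and>
      inner_semidirect_product X \<omega> Y}"

definition kernel_on :: "'a set \<Rightarrow> ('a \<Rightarrow> 'b) \<Rightarrow> ('a \<times> 'a) set"
  where "kernel_on X f = {(x, y) \<in> X \<times> X. f x = f y}"

end

(* An idempotent endomorphism e retracts X onto its image, and each kernel class meets the image in
   exactly one point, namely the common value of e on that class. Conversely, sending x to the
   unique element of Y in its class is idempotent, and it is a morphism because both the bracket
   and the product of representatives lie again in Y and in the correct class. *)

theory Submission
  imports Defs
begin

text \<open>Outside \<open>X\<close> both \<open>compose X e e\<close> and \<open>e\<close> are
  \<open>undefined\<close>, so the equation between the two maps amounts to pointwise idempotence on
  the carrier.\<close>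

lemma mem_idempotent_endomorphisms_iff:
  "e \<in> idempotent_endomorphisms X t m \<longleftrightarrow>
    e \<in> X \<rightarrow>\<^sub>E X \<and>
    (\<forall>x\<in>X. \<forall>y\<in>X. \<forall>z\<in>X. e (t x y z) = t (e x) (e y) (e z)) \<and>
    (\<forall>x\<in>X. \<forall>y\<in>X. e (m x y) = m (e x) (e y)) \<and>
    (\<forall>x\<in>X. e (e x) = e x)"
proof -
  have "compose X e e = e \<longleftrightarrow> (\<forall>x\<in>X. e (e x) = e x)" if "e \<in> X \<rightarrow>\<^sub>E X"
  proof
    assume "compose X e e = e"
    then show "\<forall>x\<in>X. e (e x) = e x"
      by (metis compose_eq)
  next
    assume "\<forall>x\<in>X. e (e x) = e x"
    then show "compose X e e = e"
      using that by (intro extensionalityI[of _ X]) (simp_all add: compose_eq PiE_iff)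
  qed
  then show ?thesis
    unfolding idempotent_endomorphisms_def near_truss_hom_def by auto
qed

text \<open>The map intended as the inverse of the correspondence. It is restricted to
  \<open>X\<close> so that it can be a member of the extensional function space
  \<open>X \<rightarrow>\<^sub>E X\<close>.\<close>

definition class_representative :: "'a set \<Rightarrow> ('a \<times> 'a) set \<Rightarrow> 'a set \<Rightarrow> 'a \<Rightarrow> 'a"
  where "class_representative X \<omega> Y = (\<lambda>x\<in>X. the_elem (Y \<inter> \<omega> `` {x}))"

text \<open>Because representatives are unique, evaluating the map reduces to exhibiting a candidate
  in \<open>Y\<close> and in the right class; all later computations go through this.\<close>

lemma class_representative_eq_iff:
  assumes "inner_semidirect_product X \<omega> Y" and "x \<in> X"
  shows "class_representative X \<omega> Y x = y \<longleftrightarrow> y \<in> Y \<and> (x, y) \<in> \<omega>"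
proof -
  obtain r where "Y \<inter> \<omega> `` {x} = {r}"
    using assms by (auto simp: inner_semidirect_product_def is_singleton_def)
  then show ?thesis
    using assms(2) by (auto simp: class_representative_def)
qed

lemma equiv_kernel_on: "equiv X (kernel_on X f)"
  by (auto simp: kernel_on_def intro!: equivI refl_onI symI transI)

lemma inner_semidirect_product_kernel_image:
  assumes "e ` X \<subseteq> X" and "\<And>x. x \<in> X \<Longrightarrow> e (e x) = e x"
  shows "inner_semidirect_product X (kernel_on X e) (e ` X)"
  unfolding inner_semidirect_product_def
proof
  fix x
  assume "x \<in> X"
  \<comment> \<open>An image point \<open>e y\<close> in the class of \<open>x\<close> satisfies
    \<open>e y = e (e y) = e x\<close>; idempotence also puts \<open>e x\<close> itself into that
    class.\<close>
  then have "e ` X \<inter> kernel_on X e `` {x} = {e x}"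
    using assms by (auto simp: kernel_on_def)
  then show "is_singleton (e ` X \<inter> kernel_on X e `` {x})"
    by simp
qed

context left_near_truss
begin

lemma kernel_image_mem_semidirect_decompositions:
  assumes "e \<in> idempotent_endomorphisms X t m"
  shows "(kernel_on X e, e ` X) \<in> semidirect_decompositions X t m"
proof -
  have e: "e \<in> X \<rightarrow> X"
    and bracket: "\<And>x y z. \<lbrakk>x \<in> X; y \<in> X; z \<in> X\<rbrakk> \<Longrightarrow> e (t x y z) = t (e x) (e y) (e z)"
    and mult: "\<And>x y. \<lbrakk>x \<in> X; y \<in> X\<rbrakk> \<Longrightarrow> e (m x y) = m (e x) (e y)"
    and idem: "\<And>x. x \<in> X \<Longrightarrow> e (e x) = e x"
    using assms by (auto simp: mem_idempotent_endomorphisms_iff)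
  have "near_truss_congruence (kernel_on X e) X t m"
    unfolding near_truss_congruence_def
    by (simp add: equiv_kernel_on)
       (auto simp: kernel_on_def bracket mult bracket_closed mult_closed)
  moreover have "subnear_truss (e ` X) X t m"
    unfolding subnear_truss_def using e
    \<comment> \<open>Read from right to left, the morphism laws display a bracket or product of
      image points as the image of a single element.\<close>
    by (auto simp flip: bracket mult intro!: imageI bracket_closed mult_closed)
  moreover have "inner_semidirect_product X (kernel_on X e) (e ` X)"
    using e idem by (intro inner_semidirect_product_kernel_image) auto
  ultimately show ?thesis
    by (simp add: semidirect_decompositions_def)
qed

text \<open>One of the two inverse laws. On \<open>X\<close>, the point \<open>e x\<close> lies in
  the image and, by idempotence, in the kernel class of \<open>x\<close>; off \<open>X\<close> both
  maps are \<open>undefined\<close>.\<close>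

lemma class_representative_kernel_image:
  assumes "e \<in> idempotent_endomorphisms X t m"
  shows "class_representative X (kernel_on X e) (e ` X) = e"
proof
  fix x
  have e: "e \<in> X \<rightarrow>\<^sub>E X" and idem: "\<And>x. x \<in> X \<Longrightarrow> e (e x) = e x"
    using assms by (auto simp: mem_idempotent_endomorphisms_iff)
  show "class_representative X (kernel_on X e) (e ` X) x = e x"
  proof (cases "x \<in> X")
    case True
    have "inner_semidirect_product X (kernel_on X e) (e ` X)"
      using e idem by (intro inner_semidirect_product_kernel_image) auto
    then show ?thesis
      using True e idem by (subst class_representative_eq_iff) (auto simp: kernel_on_def)
  next
    case False
    then show ?thesis
      using PiE_arb[OF e False] by (simp add: class_representative_def)
  qed
qed

text \<open>The reverse map lands among the idempotent endomorphisms, and the last two claims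
  together form the other inverse law.\<close>

lemma
  assumes "(\<omega>, Y) \<in> semidirect_decompositions X t m"
  shows class_representative_mem_idempotent_endomorphisms:
      "class_representative X \<omega> Y \<in> idempotent_endomorphisms X t m"
    and kernel_on_class_representative: "kernel_on X (class_representative X \<omega> Y) = \<omega>"
    and image_class_representative: "class_representative X \<omega> Y ` X = Y"
proof -
  let ?r = "class_representative X \<omega> Y"
  have cong: "near_truss_congruence \<omega> X t m" and sub: "subnear_truss Y X t m"
    and prod: "inner_semidirect_product X \<omega> Y"
    using assms by (auto simp: semidirect_decompositions_def)
  have equiv: "equiv X \<omega>"
    using cong by (simp add: near_truss_congruence_def)
  have YX: "Y \<subseteq> X"
    using sub by (simp add: subnear_truss_def)
  note eq_iff = class_representative_eq_iff[OF prod]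
  have r: "?r x \<in> Y" "(x, ?r x) \<in> \<omega>" if "x \<in> X" for x
    using eq_iff[OF that, of "?r x"] by simp_all
  \<comment> \<open>By reflexivity an element of \<open>Y\<close> represents its own class. This
    yields both idempotence and that every element of \<open>Y\<close> is attained.\<close>
  have fixed: "?r y = y" if "y \<in> Y" for y
    using that YX equiv by (auto simp: eq_iff equiv_class_eq_iff)
  \<comment> \<open>By \<open>eq_iff\<close> the right-hand side only has to lie in
    \<open>Y\<close>, by closure of \<open>Y\<close>, and in the class of \<open>t x y z\<close>, by
    compatibility of \<omega>.\<close>
  have "?r (t x y z) = t (?r x) (?r y) (?r z)" if "x \<in> X" "y \<in> X" "z \<in> X" for x y z
    using that r cong sub
    by (simp add: eq_iff bracket_closed near_truss_congruence_def subnear_truss_def)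
  moreover have "?r (m x y) = m (?r x) (?r y)" if "x \<in> X" "y \<in> X" for x y
    using that r cong sub
    by (simp add: eq_iff mult_closed near_truss_congruence_def subnear_truss_def)
  moreover have "?r \<in> X \<rightarrow>\<^sub>E X"
    using r YX by (auto simp: class_representative_def)
  ultimately show "?r \<in> idempotent_endomorphisms X t m"
    using r fixed by (simp add: mem_idempotent_endomorphisms_iff)
  show "?r ` X = Y"
    using r fixed YX by (auto simp: image_iff) (metis subsetD)
  \<comment> \<open>Since \<open>?r y\<close> lies in \<open>Y\<close>, \<open>eq_iff\<close> turns
    the equation into \<open>(x, ?r y) \<in> \<omega>\<close>, and \<open>?r y\<close> is equivalent
    to \<open>y\<close>.\<close>
  have "?r x = ?r y \<longleftrightarrow> (x, y) \<in> \<omega>" if "x \<in> X" "y \<in> X" for x y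
    using that r[of y] equiv_class_eq_iff[OF equiv] by (simp add: eq_iff)
  then show "kernel_on X ?r = \<omega>"
    \<comment> \<open>As \<omega> is contained in \<open>X \<times> X\<close>, comparing the
      relations on the carrier suffices.\<close>
    using equiv_type[OF equiv] by (auto simp: kernel_on_def)
qed

end

theorem proposition10p2:
  fixes X :: "'a set"
    and t :: "'a \<Rightarrow> 'a \<Rightarrow> 'a \<Rightarrow> 'a"
    and m :: "'a \<Rightarrow> 'a \<Rightarrow> 'a"
  assumes "left_near_truss X t m"
  shows "\<exists>\<Phi>. bij_betw \<Phi> (idempotent_endomorphisms X t m) (semidirect_decompositions X t m) \<and>
    (\<forall>e \<in> idempotent_endomorphisms X t m. \<Phi> e = (kernel_on X e, e ` X))"
proof -
  interpret left_near_truss X t m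
    by (rule assms)
  have "bij_betw (\<lambda>e. (kernel_on X e, e ` X))
    (idempotent_endomorphisms X t m) (semidirect_decompositions X t m)"
  proof (rule bij_betw_byWitness[where f' = "\<lambda>(\<omega>, Y). class_representative X \<omega> Y"])
    show "\<forall>p\<in>semidirect_decompositions X t m.
      (\<lambda>e. (kernel_on X e, e ` X)) ((\<lambda>(\<omega>, Y). class_representative X \<omega> Y) p) = p"
      by (simp add: Ball_def kernel_on_class_representative image_class_representative)
    show "(\<lambda>(\<omega>, Y). class_representative X \<omega> Y) ` semidirect_decompositions X t m
      \<subseteq> idempotent_endomorphisms X t m"
      using class_representative_mem_idempotent_endomorphisms by fast
  qed (auto simp: class_representative_kernel_image kernel_image_mem_semidirect_decompositions)
  then show ?thesis
    by blast
qed

end
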